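(* Let $F=f+r$ with $f=\frac1n\sum_{i=1}^n f_i$ on $\mathbb{R}^d$. Suppose that each $f_i$ is $L$-smooth, that $f$ is $\sigma$-weakly convex, and that $r$ is convex but possibly non-smooth, with a proximal operator that can be computed efficiently. Let $\mathbf{x}^*$ be an optimal solution, $F(\mathbf{x}^* )=\min_{\mathbf{x}}F(\mathbf{x})$, and let $\mathbf{x}_0$ be an initial solution such that $F(\mathbf{x}_0)-F(\mathbf{x}^* )\le\Delta$. Run the AdaptRdct-NC framework from $\mathbf{x}_0$ with epoch number $S$, $\lambda=\frac{1}{2\sigma}$ and inner algorithm $\mathcal{A}$, and let $\mathbf{x}_\alpha$ be its output. If $\mathcal{A}$ satisfies the ZOOD property (with constants $\delta_\mu$, $\mathcal{K}$, $\mathcal{E}$), then $$\mathbb{E}\left[\|\nabla F_\lambda(\mathbf{x}_\alpha)\|^2\right]\le\frac{8\sigma(2\mathcal{K}+1)\Delta}{(1-\mathcal{K})(S+1)}+24\sigma\delta_\mu+\frac{24\mathcal{E}}{1-\mathcal{K}}.$$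
   Context: $\|\cdot\|$ is the Euclidean norm. A function $g$ is $L$-smooth if it has continuous gradients and $|g(\mathbf{y})-g(\mathbf{x})-\langle\nabla g(\mathbf{x}),\mathbf{y}-\mathbf{x}\rangle|\le\frac L2\|\mathbf{y}-\mathbf{x}\|^2$ for all $\mathbf{x},\mathbf{y}$; it is $\sigma$-weakly convex if $g+\frac{\sigma}{2}\|\cdot\|^2$ is convex. Moreau envelope: for $\lambda>0$, $F_\lambda(\mathbf{x})=\min_{\mathbf{z}}\{F(\mathbf{z})+\frac{1}{2\lambda}\|\mathbf{z}-\mathbf{x}\|^2\}$, with minimizer denoted $\mathrm{Prox}_{\lambda F}(\mathbf{x})$. If $F$ is $\sigma$-weakly convex and $\lambda<\sigma^{-1}$, then $F_\lambda$ is smooth with $\nabla F_\lambda(\mathbf{x})=\frac{\mathbf{x}-\mathrm{Prox}_{\lambda F}(\mathbf{x})}{\lambda}$. Function query complexity (FQC): number of function evaluations. ZOOD (Zeroth-Order Objective Decrease) property: an algorithm $\mathcal{A}(F,\mathbf{x})$ for minimizing an objective $F$ satisfies the ZOOD property with complexity $\mathcal{C}(L,\gamma)$ if, for any starting point $\mathbf{x}_0$, it produces an output $\mathbf{x}'\leftarrow\mathcal{A}(F,\mathbf{x}_0)$ with FQC $\mathcal{C}(L,\gamma)$ such that $$\mathbb{E}\left[F(\mathbf{x}')-\min_{\mathbf{x}}F(\mathbf{x})-\delta_\mu\right]\le\mathcal{K}\left[F(\mathbf{x}_0)-\min_{\mathbf{x}}F(\mathbf{x})-\delta_\mu\right]+\mathcal{E},$$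 where $\delta_\mu$ is a fixed error introduced by the smoothing parameter $\mu$ of the zeroth-order gradient estimator, $0<\mathcal{K}<1$, and $\mathcal{E}$ is a constant error. AdaptRdct-NC: for $s=1,2,\dots,S$, set $F^{(s)}(\mathbf{x})=F(\mathbf{x})+\frac{1}{2\lambda}\|\mathbf{x}-\mathbf{x}_{s-1}\|^2=F(\mathbf{x})+\sigma\|\mathbf{x}-\mathbf{x}_{s-1}\|^2$ and $\mathbf{x}_s\leftarrow\mathcal{A}(F^{(s)},\mathbf{x}_{s-1})$. Output $\mathbf{x}_\alpha$ randomly chosen from $\{\mathbf{x}_s\}_{s=1}^S$.
   Formalization: The last term of the bound is corrected from 24E/(1-K) to 24σE/(1-K); the printed bound fails for large σ, e.g. F=σx² on R, x_0=0, Δ=δ_μ=0, S=1, with A returning a point of gap E, where the left side is σE/2. *)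

theory Defs
  imports "HOL-Probability.Probability"
begin

definition gradient :: "('a::real_inner \<Rightarrow> real) \<Rightarrow> 'a \<Rightarrow> 'a" where
  "gradient g x = (THE D. GDERIV g x :> D)"

definition L_smooth :: "real \<Rightarrow> ('a::real_inner \<Rightarrow> real) \<Rightarrow> bool" where
  "L_smooth L g \<longleftrightarrow>
     (\<forall>x. GDERIV g x :> gradient g x) \<and>
     continuous_on UNIV (gradient g) \<and>
     (\<forall>x y. \<bar>g y - g x - gradient g x \<bullet> (y - x)\<bar> \<le> L / 2 * (norm (y - x))\<^sup>2)"

definition weakly_convex :: "real \<Rightarrow> ('a::real_inner \<Rightarrow> real) \<Rightarrow> bool" where
  "weakly_convex \<sigma> g \<longleftrightarrow> convex_on UNIV (\<lambda>x. g x + \<sigma> / 2 * (norm x)\<^sup>2)"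

text \<open>The minimum of a real function. It is a meaningful value only if the minimum is attained.\<close>

definition min_value :: "('a \<Rightarrow> real) \<Rightarrow> real" where
  "min_value g = (LEAST v. v \<in> range g)"

definition reg_objective ::
    "('a::real_normed_vector \<Rightarrow> real) \<Rightarrow> real \<Rightarrow> 'a \<Rightarrow> 'a \<Rightarrow> real" where
  "reg_objective F lam c = (\<lambda>z. F z + 1 / (2 * lam) * (norm (z - c))\<^sup>2)"

definition moreau_envelope ::
    "real \<Rightarrow> ('a::real_normed_vector \<Rightarrow> real) \<Rightarrow> 'a \<Rightarrow> real" where
  "moreau_envelope lam F x = min_value (reg_objective F lam x)"

text \<open>
  A randomized algorithm maps an objective and a starting point to the joint law of its output
  and of the number of function evaluations it made. Any further knowledge the algorithm uses
  (a finite-sum decomposition, a proximal operator, step sizes) is part of the algorithm.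
\<close>

type_synonym 'a algorithm = "('a \<Rightarrow> real) \<Rightarrow> 'a \<Rightarrow> ('a \<times> nat) measure"

abbreviation run_space :: "('a::topological_space \<times> nat) measure" where
  "run_space \<equiv> borel \<Otimes>\<^sub>M count_space UNIV"

text \<open>
  The ZOOD property with complexity C(L, \<open>\<gamma>\<close>) and constants \<open>\<delta>\<close>, K, E for the objective G.
  Integrability is required because the Bochner integral of a non-integrable function is 0.
\<close>

definition ZOOD ::
    "'a::topological_space algorithm \<Rightarrow> ('a \<Rightarrow> real) \<Rightarrow> (real \<Rightarrow> real \<Rightarrow> nat) \<Rightarrow>
     real \<Rightarrow> real \<Rightarrow> real \<Rightarrow> real \<Rightarrow> real \<Rightarrow> bool" where
  "ZOOD A G C L \<gamma> \<delta> K E \<longleftrightarrow>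
     0 \<le> \<delta> \<and> 0 < K \<and> K < 1 \<and> 0 \<le> E \<and>
     (\<forall>x0. A G x0 \<in> space (prob_algebra run_space) \<and>
        (AE p in A G x0. snd p \<le> C L \<gamma>) \<and>
        integrable (A G x0) (\<lambda>p. G (fst p)) \<and>
        (\<integral>p. (G (fst p) - min_value G - \<delta>) \<partial>A G x0)
          \<le> K * (G x0 - min_value G - \<delta>) + E)"

text \<open>
  The law of the s-th iterate. Each call of the inner algorithm uses fresh randomness, so the
  iterates form a Markov chain.
\<close>

primrec AdaptRdct_NC_iterate ::
    "'a::real_normed_vector algorithm \<Rightarrow> ('a \<Rightarrow> real) \<Rightarrow> real \<Rightarrow> 'a \<Rightarrow> nat \<Rightarrow> 'a measure" where
  "AdaptRdct_NC_iterate A F lam x0 0 = return borel x0"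
| "AdaptRdct_NC_iterate A F lam x0 (Suc s) =
     AdaptRdct_NC_iterate A F lam x0 s \<bind>
       (\<lambda>x. distr (A (reg_objective F lam x) x) borel fst)"

text \<open>The law of the output: an iterate whose index is uniform on 1, ..., S and independent of
  the run.\<close>

definition AdaptRdct_NC ::
    "'a::real_normed_vector algorithm \<Rightarrow> ('a \<Rightarrow> real) \<Rightarrow> real \<Rightarrow> 'a \<Rightarrow> nat \<Rightarrow> 'a measure" where
  "AdaptRdct_NC A F lam x0 S =
     measure_pmf (pmf_of_set {1..S}) \<bind> AdaptRdct_NC_iterate A F lam x0"

end

theory Submission
  imports Defs
begin

text \<open>
  Write \<open>G\<^sub>x = F + \<sigma> \<parallel>\<cdot> - x\<parallel>\<^sup>2\<close> for the objective of an epoch started at \<open>x\<close>, \<open>p(x)\<close> for its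
  minimizer and \<open>F\<^sub>\<lambda>(x)\<close> for its minimum. Since \<open>F\<close> is \<open>\<sigma>\<close>-weakly convex, \<open>G\<^sub>x\<close> is
  \<open>\<sigma>\<close>-strongly convex and grows quadratically around \<open>p(x)\<close>. This makes \<open>p\<close> Lipschitz, yields
  \<open>\<nabla>F\<^sub>\<lambda>(x) = 2 \<sigma> (x - p(x))\<close>, and with the residual \<open>B(x) = \<sigma>/2 \<parallel>x - p(x)\<parallel>\<^sup>2\<close>, so that
  \<open>\<parallel>\<nabla>F\<^sub>\<lambda>\<parallel>\<^sup>2 = 8 \<sigma> B\<close>, the two bounds \<open>B(x) \<le> F(x) - F\<^sub>\<lambda>(x)\<close> and \<open>3 B(x) \<le> F(x) - min F\<close>.

  An epoch from \<open>x\<close> to \<open>y\<close> with inexactness \<open>q = G\<^sub>x(y) - F\<^sub>\<lambda>(x)\<close> satisfies the identity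
  \<open>F(y) = F(x) - (F(x) - F\<^sub>\<lambda>(x)) - \<sigma> \<parallel>y - x\<parallel>\<^sup>2 + q\<close>. The envelope gap alone gives a decrease
  of \<open>B(x)\<close> at least; the quadratic term is worth another \<open>B(x)\<close> up to \<open>2 q\<close>, as \<open>y\<close> is close to
  \<open>p(x)\<close> when \<open>q\<close> is small. Using a fraction \<open>t\<close> of the quadratic term and the ZOOD bound
  \<open>\<E>[q] \<le> K (F(x) - F\<^sub>\<lambda>(x)) + \<eta>\<close>, with \<open>\<E>\<close> the expectation and \<open>\<eta> = (1 - K) \<delta> + E\<close>, one gets
  \<open>\<E>[F(y)] + \<kappa> B(x) \<le> F(x) + (1 + 2 t) \<eta>\<close>, where \<open>\<kappa> = 1 - K + t (1 - 2 K)\<close>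
  (lemma \<open>expected_step_decrease\<close>).

  This drift inequality is summed along the Markov chain of the iterates
  (lemma \<open>nn_integral_drift_sum\<close>). The sum controls the residuals of \<open>x\<^sub>0, \<dots>, x\<^sub>S\<^sub>-\<^sub>1\<close>,
  whereas the output is drawn from \<open>x\<^sub>1, \<dots>, x\<^sub>S\<close>. The residual of \<open>x\<^sub>S\<close> is paid for by the
  terminal gap \<open>F(x\<^sub>S) - min F \<ge> 3 B(x\<^sub>S)\<close>. Hence the mean residual is at most
  \<open>\<Delta> / (\<kappa> S) + (1 + 2 t) \<eta> / \<kappa>\<close>. The denominator \<open>S + 1\<close> in the claim is a matter of the
  choice of \<open>t\<close>: for \<open>K \<ge> 1/2\<close> the factor \<open>2 K + 1\<close> makes up for it with \<open>t = 0\<close>, and for smaller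
  \<open>K\<close> a positive \<open>t\<close> makes \<open>\<kappa>\<close> large enough (lemma \<open>rate_constants\<close>).
\<close>

section \<open>Strong convexity, quadratic models and gradients\<close>

text \<open>
  On the segment from \<open>p\<close> to \<open>z\<close> strong convexity bounds \<open>g\<close> by its chord minus
  \<open>m/2 \<theta> (1 - \<theta>) \<parallel>z - p\<parallel>\<^sup>2\<close>. Minimality at \<open>p\<close> allows division by \<open>\<theta>\<close>, and then \<open>\<theta>\<close> tends to 0.
\<close>

lemma quadratic_growth_at_minimizer:
  fixes g :: "'a::real_inner \<Rightarrow> real"
  assumes conv: "convex_on UNIV (\<lambda>x. g x - m / 2 * (norm x)\<^sup>2)"
    and min: "\<And>x. g p \<le> g x"
  shows "g p + m / 2 * (norm (z - p))\<^sup>2 \<le> g z"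
proof -
  have chord: "m / 2 * (1 - \<theta>) * (norm (z - p))\<^sup>2 \<le> g z - g p" if \<theta>: "0 < \<theta>" "\<theta> < 1" for \<theta>
  proof -
    define w where "w = (1 - \<theta>) *\<^sub>R p + \<theta> *\<^sub>R z"
    have "g w - m / 2 * (norm w)\<^sup>2
        \<le> (1 - \<theta>) * (g p - m / 2 * (norm p)\<^sup>2) + \<theta> * (g z - m / 2 * (norm z)\<^sup>2)"
      using convex_onD[OF conv, of \<theta> p z] \<theta> by (simp add: w_def)
    moreover have "(norm w)\<^sup>2 = (1 - \<theta>) * (norm p)\<^sup>2 + \<theta> * (norm z)\<^sup>2 - \<theta> * (1 - \<theta>) * (norm (z - p))\<^sup>2"
      by (simp add: w_def power2_norm_eq_inner inner_simps inner_commute[of z p]) algebra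
    ultimately have "g w \<le> (1 - \<theta>) * g p + \<theta> * g z - m / 2 * (\<theta> * (1 - \<theta>) * (norm (z - p))\<^sup>2)"
      by (simp add: algebra_simps add_divide_distrib diff_divide_distrib)
    with min[of w] have "0 \<le> \<theta> * (g z - g p - m / 2 * (1 - \<theta>) * (norm (z - p))\<^sup>2)"
      by (simp add: algebra_simps add_divide_distrib diff_divide_distrib)
    with \<theta> show ?thesis by (simp add: zero_le_mult_iff)
  qed
  have "((\<lambda>\<theta>. m / 2 * (1 - \<theta>) * (norm (z - p))\<^sup>2) \<longlongrightarrow> m / 2 * (1 - 0) * (norm (z - p))\<^sup>2) (at_right 0)"
    by (intro tendsto_intros)
  moreover have "eventually (\<lambda>\<theta>. m / 2 * (1 - \<theta>) * (norm (z - p))\<^sup>2 \<le> g z - g p) (at_right 0)"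
    using eventually_at_right_real[of 0 "1::real"] chord by (auto elim!: eventually_mono simp del: times_divide_eq_left)
  ultimately have "m / 2 * (1 - 0) * (norm (z - p))\<^sup>2 \<le> g z - g p"
    by (rule tendsto_upperbound) simp
  then show ?thesis by simp
qed

lemma GDERIV_of_quadratic_remainder:
  fixes g :: "'a::real_inner \<Rightarrow> real"
  assumes rem: "\<And>y. \<bar>g y - g x - D \<bullet> (y - x)\<bar> \<le> c * (norm (y - x))\<^sup>2"
  shows "GDERIV g x :> D"
  unfolding gderiv_def has_derivative_at
proof (intro conjI)
  show "bounded_linear (\<lambda>h. h \<bullet> D)"
    by (rule bounded_linear_inner_left)
  show "(\<lambda>h. norm (g (x + h) - g x - h \<bullet> D) / norm h) \<midarrow>0\<rightarrow> 0"
  proof (rule Lim_null_comparison)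
    show "\<forall>\<^sub>F h in at 0. norm (norm (g (x + h) - g x - h \<bullet> D) / norm h) \<le> c * norm h"
    proof (rule eventuallyI)
      fix h :: 'a
      show "norm (norm (g (x + h) - g x - h \<bullet> D) / norm h) \<le> c * norm h"
        using rem[of "x + h"]
        by (cases "h = 0") (simp_all add: inner_commute power2_eq_square field_simps)
    qed
    have "((\<lambda>h::'a. c * norm h) \<longlongrightarrow> c * norm (0::'a)) (at 0)"
      by (intro tendsto_intros)
    then show "((\<lambda>h::'a. c * norm h) \<longlongrightarrow> 0) (at 0)" by simp
  qed
qed

lemma gradient_eqI: "GDERIV g x :> D \<Longrightarrow> gradient g x = D"
  unfolding gradient_def
proof (rule the_equality, assumption)
  fix D' assume "GDERIV g x :> D" "GDERIV g x :> D'"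
  then have "(\<lambda>h. h \<bullet> D') = (\<lambda>h. h \<bullet> D)"
    unfolding gderiv_def by (blast dest: has_derivative_unique)
  then show "D' = D" by (simp add: fun_eq_iff vector_eq_ldot)
qed

lemma min_value_eqI:
  assumes "\<And>z. g p \<le> g z"
  shows "min_value g = g p"
  unfolding min_value_def by (rule Least_equality) (use assms in auto)

lemma weakly_convex_add_convex:
  assumes "weakly_convex \<sigma> f" "convex_on UNIV r"
  shows "weakly_convex \<sigma> (\<lambda>x. f x + r x)"
  using convex_on_add[OF assms[unfolded weakly_convex_def]]
  by (simp add: weakly_convex_def algebra_simps)

section \<open>The proximal map and the Moreau envelope\<close>

text \<open>
  The proximal parameter is the one of the algorithm, \<open>1 / (2 \<sigma>)\<close>, for which the penalty is
  \<open>\<sigma> \<parallel>z - c\<parallel>\<^sup>2\<close>: half of it restores convexity, the other half provides strong convexity.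
\<close>

locale weakly_convex_min =
  fixes F :: "'a::euclidean_space \<Rightarrow> real" and \<sigma> :: real and xopt :: 'a
  assumes sigma_pos: "0 < \<sigma>"
    and objective_weakly_convex: "weakly_convex \<sigma> F"
    and minimal: "F xopt \<le> F x"
begin

abbreviation reg :: "'a \<Rightarrow> 'a \<Rightarrow> real" where
  "reg \<equiv> reg_objective F (1 / (2 * \<sigma>))"

abbreviation envelope :: "'a \<Rightarrow> real" where
  "envelope \<equiv> moreau_envelope (1 / (2 * \<sigma>)) F"

definition prox :: "'a \<Rightarrow> 'a" where
  "prox c = (SOME p. \<forall>z. reg c p \<le> reg c z)"

lemma reg_eq: "reg c z = F z + \<sigma> * (norm (z - c))\<^sup>2"
  by (simp add: reg_objective_def)

lemma objective_continuous: "continuous_on UNIV F"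
proof -
  have "continuous_on UNIV (\<lambda>x. F x + \<sigma> / 2 * (norm x)\<^sup>2)"
    using objective_weakly_convex unfolding weakly_convex_def by (intro convex_on_continuous) auto
  then have "continuous_on UNIV (\<lambda>x. (F x + \<sigma> / 2 * (norm x)\<^sup>2) - \<sigma> / 2 * (norm x)\<^sup>2)"
    by (rule continuous_on_diff) (intro continuous_intros)
  then show ?thesis by simp
qed

text \<open>
  The penalty is coercive and \<open>F\<close> is bounded below, so only a ball has to be searched.
\<close>

lemma reg_attains_min: "\<exists>p. \<forall>z. reg c p \<le> reg c z"
proof -
  \<comment> \<open>Outside this ball the penalty alone exceeds the gap at the center; the summand 1 gives
    \<open>R \<le> R\<^sup>2\<close>.\<close>
  define R where "R = 1 + (F c - F xopt) / \<sigma>"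
  have R: "1 \<le> R" using minimal[of c] sigma_pos by (simp add: R_def)
  have "continuous_on (cball c R) (reg c)"
    unfolding reg_eq by (intro continuous_intros continuous_on_subset[OF objective_continuous]) auto
  then obtain p where p: "p \<in> cball c R" "\<And>z. z \<in> cball c R \<Longrightarrow> reg c p \<le> reg c z"
    using continuous_attains_inf[of "cball c R" "reg c"] R by fastforce
  have "reg c p \<le> reg c z" for z
  proof (cases "z \<in> cball c R")
    case False
    then have "R \<le> norm (z - c)" by (simp add: dist_norm norm_minus_commute)
    with R have "R * 1 \<le> norm (z - c) * norm (z - c)" by (intro mult_mono) auto
    then have "\<sigma> * R \<le> \<sigma> * (norm (z - c))\<^sup>2"
      using sigma_pos by (simp add: power2_eq_square)
    moreover have "F c - F xopt \<le> \<sigma> * R" using sigma_pos by (simp add: R_def field_simps)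
    moreover have "reg c p \<le> F c" using p(2)[of c] R by (simp add: reg_eq)
    ultimately show ?thesis using minimal[of z] by (simp add: reg_eq)
  qed (rule p(2))
  then show ?thesis by blast
qed

lemma prox_minimal: "reg c (prox c) \<le> reg c z"
  unfolding prox_def using someI_ex[OF reg_attains_min, of c] by blast

lemma envelope_eq: "envelope c = reg c (prox c)"
  unfolding moreau_envelope_def by (rule min_value_eqI) (rule prox_minimal)

lemma reg_growth: "envelope c + \<sigma> / 2 * (norm (z - prox c))\<^sup>2 \<le> reg c z"
  unfolding envelope_eq
proof (rule quadratic_growth_at_minimizer[where g = "reg c", OF _ prox_minimal])
  have "convex_on UNIV (\<lambda>x. (F x + \<sigma> / 2 * (norm x)\<^sup>2) + (\<sigma> * (norm c)\<^sup>2 + (- 2 * \<sigma>) * (x \<bullet> c)))"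
  proof (rule convex_on_add)
    show "convex_on UNIV (\<lambda>x. F x + \<sigma> / 2 * (norm x)\<^sup>2)"
      using objective_weakly_convex unfolding weakly_convex_def .
    show "convex_on UNIV (\<lambda>x. \<sigma> * (norm c)\<^sup>2 + (- 2 * \<sigma>) * (x \<bullet> c))"
      unfolding convex_on_def by (auto simp: inner_simps algebra_simps) (simp flip: distrib_right distrib_left)
  qed
  moreover have "reg c x - \<sigma> / 2 * (norm x)\<^sup>2
      = (F x + \<sigma> / 2 * (norm x)\<^sup>2) + (\<sigma> * (norm c)\<^sup>2 + (- 2 * \<sigma>) * (x \<bullet> c))" for x
    unfolding reg_eq
    by (simp add: power2_norm_eq_inner inner_simps inner_commute[of c x] algebra_simps)
  ultimately show "convex_on UNIV (\<lambda>x. reg c x - \<sigma> / 2 * (norm x)\<^sup>2)" by (simp only:)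
qed

text \<open>
  Adding the growth of \<open>G\<^sub>x\<close> at \<open>p(y)\<close> and of \<open>G\<^sub>y\<close> at \<open>p(x)\<close> cancels all values of \<open>F\<close> and leaves
  \<open>\<sigma> \<parallel>p(x) - p(y)\<parallel>\<^sup>2 \<le> 2 \<sigma> \<langle>x - y, p(x) - p(y)\<rangle>\<close>.
\<close>

lemma prox_lipschitz: "norm (prox x - prox y) \<le> 2 * norm (x - y)"
proof (cases "prox x = prox y")
  case False
  have "\<sigma> * (norm (prox x - prox y))\<^sup>2 \<le> 2 * \<sigma> * ((x - y) \<bullet> (prox x - prox y))"
    using reg_growth[of x "prox y"] reg_growth[of y "prox x"]
    by (simp add: envelope_eq reg_eq norm_minus_commute[of "prox y" "prox x"])
      (simp add: power2_norm_eq_inner inner_simps inner_commute algebra_simps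
        add_divide_distrib diff_divide_distrib)
  also have "\<dots> \<le> 2 * \<sigma> * (norm (x - y) * norm (prox x - prox y))"
    using sigma_pos norm_cauchy_schwarz by (intro mult_left_mono) auto
  finally have "(\<sigma> * norm (prox x - prox y)) * norm (prox x - prox y)
      \<le> (\<sigma> * norm (prox x - prox y)) * (2 * norm (x - y))"
    by (simp add: power2_eq_square algebra_simps)
  then show ?thesis using False sigma_pos
    by (subst (asm) mult_le_cancel_left_pos) auto
qed simp

text \<open>
  The point \<open>p(x)\<close> competes in the minimum that defines the envelope at \<open>y\<close>.
\<close>

lemma envelope_upper_model:
  "envelope y \<le> envelope x + (2 * \<sigma>) * ((x - prox x) \<bullet> (y - x)) + \<sigma> * (norm (y - x))\<^sup>2"
  using prox_minimal[of y "prox x"]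
  by (simp add: envelope_eq reg_eq)
    (simp add: power2_norm_eq_inner inner_simps inner_commute algebra_simps)

text \<open>
  The upper model at \<open>x\<close> bounds the linearization error from above. Exchanging \<open>x\<close> and \<open>y\<close> in it
  bounds the error from below, once \<open>p(y)\<close> is replaced by \<open>p(x)\<close> at a quadratic cost, which the
  Lipschitz bound provides.
\<close>

lemma gradient_envelope: "gradient envelope x = (2 * \<sigma>) *\<^sub>R (x - prox x)"
proof (rule gradient_eqI, rule GDERIV_of_quadratic_remainder)
  fix y
  have "(prox y - prox x) \<bullet> (y - x) \<le> norm (prox y - prox x) * norm (y - x)"
    by (rule norm_cauchy_schwarz)
  also have "\<dots> \<le> 2 * norm (y - x) * norm (y - x)"
    by (intro mult_right_mono prox_lipschitz) simp
  finally have "2 * \<sigma> * ((prox y - prox x) \<bullet> (y - x)) \<le> 2 * \<sigma> * (2 * (norm (y - x))\<^sup>2)"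
    using sigma_pos by (intro mult_left_mono) (auto simp: power2_eq_square)
  moreover have "2 * \<sigma> * ((y - prox y) \<bullet> (x - y))
      = - (2 * \<sigma> * ((x - prox x) \<bullet> (y - x))) - 2 * \<sigma> * (norm (y - x))\<^sup>2
        + 2 * \<sigma> * ((prox y - prox x) \<bullet> (y - x))"
    by (simp add: power2_norm_eq_inner inner_simps inner_commute algebra_simps)
  moreover have "0 \<le> \<sigma> * (norm (y - x))\<^sup>2" using sigma_pos by simp
  ultimately show "\<bar>envelope y - envelope x - ((2 * \<sigma>) *\<^sub>R (x - prox x)) \<bullet> (y - x)\<bar>
      \<le> (3 * \<sigma>) * (norm (y - x))\<^sup>2"
    using envelope_upper_model[of y x]
      envelope_upper_model[of x y, unfolded norm_minus_commute[of x y]]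
    unfolding inner_scaleR_left abs_le_iff by linarith
qed

text \<open>The normalization is that of the quadratic growth of the regularized objective.\<close>

definition residual :: "'a \<Rightarrow> real" where
  "residual x = \<sigma> / 2 * (norm (x - prox x))\<^sup>2"

lemma gradient_envelope_residual: "(norm (gradient envelope x))\<^sup>2 = 8 * \<sigma> * residual x"
  using sigma_pos by (simp add: gradient_envelope residual_def power_mult_distrib power2_eq_square)

lemma residual_nonneg: "0 \<le> residual x"
  using sigma_pos by (simp add: residual_def)

lemma residual_measurable [measurable]: "residual \<in> borel_measurable borel"
proof -
  have "2-lipschitz_on UNIV prox"
    by (rule lipschitz_onI) (auto simp: dist_norm prox_lipschitz)
  then have "continuous_on UNIV prox" by (rule lipschitz_on_continuous_on)
  then have "continuous_on UNIV residual"
    unfolding residual_def by (intro continuous_intros)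
  then show ?thesis by (rule borel_measurable_continuous_onI)
qed

lemma objective_measurable [measurable]: "F \<in> borel_measurable borel"
  using objective_continuous by (rule borel_measurable_continuous_onI)

lemma residual_le_envelope_gap: "residual x \<le> F x - envelope x"
  using reg_growth[of x x] by (simp add: reg_eq residual_def)

text \<open>
  Passing from \<open>x\<close> to \<open>p(x)\<close> lowers \<open>F\<close> by the envelope gap and additionally by the penalty
  \<open>\<sigma> \<parallel>p(x) - x\<parallel>\<^sup>2\<close>, which is twice the residual.
\<close>

lemma three_residual_le_gap: "3 * residual x \<le> F x - F xopt"
  using residual_le_envelope_gap[of x] minimal[of "prox x"]
  by (simp add: envelope_eq reg_eq residual_def norm_minus_commute)

section \<open>Decrease in one epoch\<close>

text \<open>
  By definition \<open>F(y)\<close> is \<open>G\<^sub>x(y) - \<sigma> \<parallel>y - x\<parallel>\<^sup>2\<close>. The triangle inequality through \<open>y\<close> and quadratic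
  growth give \<open>B(x) \<le> \<sigma> \<parallel>y - x\<parallel>\<^sup>2 + 2 (G\<^sub>x(y) - F\<^sub>\<lambda>(x))\<close>. The weight \<open>t\<close> says how much of this
  second source of decrease is used, at the price of a larger inexactness term.
\<close>

lemma inexact_step_decrease:
  assumes t: "0 \<le> t" "t \<le> 1"
  shows "F y + (F x - envelope x) + t * residual x \<le> F x + (1 + 2 * t) * (reg x y - envelope x)"
proof -
  have tri: "norm (x - prox x) \<le> norm (y - x) + norm (y - prox x)"
    using norm_triangle_ineq[of "x - y" "y - prox x"] by (simp add: norm_minus_commute)
  have "(norm (x - prox x))\<^sup>2 \<le> (norm (y - x) + norm (y - prox x))\<^sup>2"
    using tri by (intro power_mono) auto
  also have "\<dots> \<le> 2 * (norm (y - x))\<^sup>2 + 2 * (norm (y - prox x))\<^sup>2"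
    using zero_le_power2[of "norm (y - x) - norm (y - prox x)"]
    by (simp add: power2_eq_square algebra_simps)
  finally have "\<sigma> / 2 * (norm (x - prox x))\<^sup>2
      \<le> \<sigma> / 2 * (2 * (norm (y - x))\<^sup>2 + 2 * (norm (y - prox x))\<^sup>2)"
    using sigma_pos by (intro mult_left_mono) auto
  then have "residual x \<le> \<sigma> * (norm (y - x))\<^sup>2 + 2 * (reg x y - envelope x)"
    using reg_growth[of x y] by (simp add: residual_def algebra_simps)
  then have "t * residual x \<le> t * (\<sigma> * (norm (y - x))\<^sup>2 + 2 * (reg x y - envelope x))"
    using t by (intro mult_left_mono)
  moreover have "t * (\<sigma> * (norm (y - x))\<^sup>2) \<le> 1 * (\<sigma> * (norm (y - x))\<^sup>2)"
    using t sigma_pos by (intro mult_right_mono) auto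
  ultimately show ?thesis unfolding reg_eq by (simp add: algebra_simps)
qed

text \<open>
  The contraction part of the expected inexactness is absorbed by the envelope gap. What is left
  of the gap has the coefficient \<open>1 - K - 2 t K\<close>, which must be nonnegative for the gap to be
  replaced by the smaller residual. The inequality is stated in the extended nonnegative reals, so
  that it can be integrated along the chain before integrability is known.
\<close>

lemma expected_step_decrease:
  assumes t: "0 \<le> t" "t \<le> 1" "2 * t * K \<le> 1 - K"
    and P: "prob_space P" "sets P = sets borel"
    and int: "integrable P (reg x)"
    and dec: "(\<integral>y. (reg x y - envelope x - \<delta>) \<partial>P) \<le> K * (F x - envelope x - \<delta>) + E"
    and nonneg: "0 \<le> (1 - K) * \<delta> + E"
  shows "(\<integral>\<^sup>+y. ennreal (F y - F xopt) \<partial>P) + ennreal ((1 - K + t * (1 - 2 * K)) * residual x)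
    \<le> ennreal (F x - F xopt) + ennreal ((1 + 2 * t) * ((1 - K) * \<delta> + E))"
proof -
  interpret prob_space P by fact
  have [measurable]: "F \<in> borel_measurable P"
    using objective_measurable P(2) measurable_cong_sets by blast
  have F_int: "integrable P F"
  proof -
    have "integrable P (\<lambda>y. F y - F xopt)"
    proof (rule Bochner_Integration.integrable_bound)
      show "integrable P (\<lambda>y. reg x y - F xopt)" using int by simp
      show "AE y in P. norm (F y - F xopt) \<le> norm (reg x y - F xopt)"
      proof (rule AE_I2)
        fix y
        have "F y \<le> reg x y" unfolding reg_eq using sigma_pos by simp
        then show "norm (F y - F xopt) \<le> norm (reg x y - F xopt)" using minimal[of y] by simp
      qed
    qed simp
    then have "integrable P (\<lambda>y. (F y - F xopt) + F xopt)"
      by (rule Bochner_Integration.integrable_add) simp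
    then show ?thesis by simp
  qed
  define q where "q = (\<integral>y. (reg x y - envelope x) \<partial>P)"
  have q_int: "integrable P (\<lambda>y. reg x y - envelope x)" using int by simp
  have "q - \<delta> = (\<integral>y. (reg x y - envelope x - \<delta>) \<partial>P)"
    unfolding q_def using q_int by (subst Bochner_Integration.integral_diff) (auto simp: prob_space)
  with dec have q: "q \<le> K * (F x - envelope x) + ((1 - K) * \<delta> + E)"
    by (simp add: algebra_simps)
  have "(\<integral>y. F y - F xopt \<partial>P) \<le>
      (\<integral>y. envelope x - t * residual x - F xopt + (1 + 2 * t) * (reg x y - envelope x) \<partial>P)"
  proof (rule integral_mono)
    fix y
    show "F y - F xopt
        \<le> envelope x - t * residual x - F xopt + (1 + 2 * t) * (reg x y - envelope x)"
      using inexact_step_decrease[OF t(1,2), of y x] by simp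
  qed (use F_int q_int in auto)
  also have "\<dots> = envelope x - t * residual x - F xopt + (1 + 2 * t) * q"
    unfolding q_def using q_int by (subst Bochner_Integration.integral_add) (auto simp: prob_space)
  also have "\<dots> \<le> envelope x - t * residual x - F xopt
      + (1 + 2 * t) * (K * (F x - envelope x) + ((1 - K) * \<delta> + E))"
    using q t by (intro add_left_mono mult_left_mono) auto
  finally have "(\<integral>y. F y - F xopt \<partial>P) + (1 - K - 2 * t * K) * (F x - envelope x) + t * residual x
      \<le> F x - F xopt + (1 + 2 * t) * ((1 - K) * \<delta> + E)"
    by (simp add: algebra_simps)
  moreover have "(1 - K - 2 * t * K) * residual x \<le> (1 - K - 2 * t * K) * (F x - envelope x)"
    using t by (intro mult_left_mono residual_le_envelope_gap) auto
  ultimately have main: "(\<integral>y. F y - F xopt \<partial>P) + (1 - K + t * (1 - 2 * K)) * residual x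
      \<le> F x - F xopt + (1 + 2 * t) * ((1 - K) * \<delta> + E)"
    by (simp add: algebra_simps)
  have "(\<integral>\<^sup>+y. ennreal (F y - F xopt) \<partial>P) = ennreal (\<integral>y. F y - F xopt \<partial>P)"
    using F_int minimal by (intro nn_integral_eq_integral) auto
  moreover have "0 \<le> (\<integral>y. F y - F xopt \<partial>P)" by (rule Bochner_Integration.integral_nonneg) (simp add: minimal)
  moreover have "0 \<le> 1 - K + t * (1 - 2 * K)" using t by (simp add: algebra_simps)
  ultimately show ?thesis
    using main residual_nonneg[of x] minimal[of x] nonneg t
    by (simp flip: ennreal_plus)
qed

end

section \<open>Summing a drift inequality along a Markov chain\<close>

text \<open>
  Integrating the drift condition against the law at time \<open>s\<close> gives a telescoping inequality
  between consecutive times; it is the discrete Dynkin (Foster--Lyapunov) comparison.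
\<close>

lemma nn_integral_drift_sum:
  fixes M :: "nat \<Rightarrow> 'a measure"
  assumes kernel: "k \<in> N \<rightarrow>\<^sub>M prob_algebra N"
    and start: "M 0 \<in> space (prob_algebra N)"
    and step: "\<And>s. M (Suc s) = M s \<bind> k"
    and [measurable]: "\<phi> \<in> borel_measurable N" "\<beta> \<in> borel_measurable N"
    and drift: "\<And>x. x \<in> space N \<Longrightarrow> (\<integral>\<^sup>+y. \<phi> y \<partial>k x) + \<beta> x \<le> \<phi> x + c"
  shows "M S \<in> space (prob_algebra N)"
    and "(\<integral>\<^sup>+x. \<phi> x \<partial>M S) + (\<Sum>s<S. \<integral>\<^sup>+x. \<beta> x \<partial>M s) \<le> (\<integral>\<^sup>+x. \<phi> x \<partial>M 0) + of_nat S * c"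
proof -
  have prob: "M s \<in> space (prob_algebra N)" for s
  proof (induction s)
    case (Suc s)
    have "(\<lambda>_::unit. M s \<bind> k) \<in> count_space UNIV \<rightarrow>\<^sub>M prob_algebra N"
      by (rule measurable_bind_prob_space[OF _ kernel]) (use Suc in auto)
    then show ?case using measurable_space[of _ "count_space UNIV" "prob_algebra N" "()"] step
      by fastforce
  qed (rule start)
  then show "M S \<in> space (prob_algebra N)" .
  have one: "(\<integral>\<^sup>+x. \<phi> x \<partial>M (Suc s)) + (\<integral>\<^sup>+x. \<beta> x \<partial>M s) \<le> (\<integral>\<^sup>+x. \<phi> x \<partial>M s) + c" for s
  proof -
    have sets: "sets (M s) = sets N" and "prob_space (M s)"
      using prob[of s] by (auto simp: space_prob_algebra)
    interpret prob_space "M s" by fact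
    have k [measurable]: "k \<in> M s \<rightarrow>\<^sub>M subprob_algebra N"
      using measurable_prob_algebraD[OF kernel] sets measurable_cong_sets by blast
    have [measurable]: "\<phi> \<in> borel_measurable (M s)" "\<beta> \<in> borel_measurable (M s)"
      using assms(4,5) sets measurable_cong_sets by blast+
    have "(\<integral>\<^sup>+x. \<phi> x \<partial>M (Suc s)) + (\<integral>\<^sup>+x. \<beta> x \<partial>M s) = (\<integral>\<^sup>+x. (\<integral>\<^sup>+y. \<phi> y \<partial>k x) + \<beta> x \<partial>M s)"
      unfolding step by (subst nn_integral_bind[OF assms(4) k], subst nn_integral_add) auto
    also have "\<dots> \<le> (\<integral>\<^sup>+x. \<phi> x + c \<partial>M s)"
      using drift sets_eq_imp_space_eq[OF sets] by (intro nn_integral_mono) auto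
    also have "\<dots> = (\<integral>\<^sup>+x. \<phi> x \<partial>M s) + c"
      by (subst nn_integral_add) (auto simp: emeasure_space_1)
    finally show ?thesis .
  qed
  show "(\<integral>\<^sup>+x. \<phi> x \<partial>M S) + (\<Sum>s<S. \<integral>\<^sup>+x. \<beta> x \<partial>M s) \<le> (\<integral>\<^sup>+x. \<phi> x \<partial>M 0) + of_nat S * c"
  proof (induction S)
    case (Suc S)
    have "(\<integral>\<^sup>+x. \<phi> x \<partial>M (Suc S)) + (\<Sum>s<Suc S. \<integral>\<^sup>+x. \<beta> x \<partial>M s)
        = ((\<integral>\<^sup>+x. \<phi> x \<partial>M (Suc S)) + (\<integral>\<^sup>+x. \<beta> x \<partial>M S)) + (\<Sum>s<S. \<integral>\<^sup>+x. \<beta> x \<partial>M s)"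
      by (simp add: algebra_simps)
    also have "\<dots> \<le> ((\<integral>\<^sup>+x. \<phi> x \<partial>M S) + c) + (\<Sum>s<S. \<integral>\<^sup>+x. \<beta> x \<partial>M s)"
      by (intro add_right_mono one)
    also have "\<dots> = ((\<integral>\<^sup>+x. \<phi> x \<partial>M S) + (\<Sum>s<S. \<integral>\<^sup>+x. \<beta> x \<partial>M s)) + c"
      by (simp add: algebra_simps)
    also have "\<dots> \<le> ((\<integral>\<^sup>+x. \<phi> x \<partial>M 0) + of_nat S * c) + c"
      by (intro add_right_mono Suc)
    finally show ?case by (simp add: algebra_simps)
  qed simp
qed

section \<open>The rate\<close>

text \<open>
  Comparing the coefficients of \<open>\<Delta>\<close> and of \<open>\<eta>\<close> separately, it suffices that
  \<open>(1 - K) (S + 1) \<le> \<kappa> S (2 K + 1)\<close> and \<open>(1 + 2 t) (1 - K) \<le> 3 \<kappa>\<close>. If \<open>K \<ge> 1/2\<close>, then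
  \<open>S + 1 \<le> S (2 K + 1)\<close> and \<open>t = 0\<close> will do. Otherwise, as \<open>S + 1 \<le> 2 S\<close>, the first condition
  follows from \<open>2 (1 - K) \<le> \<kappa> (2 K + 1)\<close>. With \<open>t = 1\<close> the two sides differ by
  \<open>3 K (1 - 2 K)\<close>, but \<open>t = 1\<close> is too large for the constraint \<open>2 t K \<le> 1 - K\<close> once \<open>K > 1/3\<close>.
  With \<open>t = 1/2\<close> the constraint holds up to \<open>K = 1/2\<close>, and the sides differ by
  \<open>(4 K - 1) (1 - 2 K) / 2\<close>, which is nonnegative from \<open>K = 1/4\<close> on.
\<close>

lemma rate_constants:
  fixes K \<Delta> \<eta> :: real and S :: nat
  assumes K: "0 < K" "K < 1" and S: "1 \<le> S" and nonneg: "0 \<le> \<Delta>" "0 \<le> \<eta>"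
  obtains t \<kappa> where "0 \<le> t" "t \<le> 1" "2 * t * K \<le> 1 - K"
    and "\<kappa> = 1 - K + t * (1 - 2 * K)" "0 < \<kappa>" "\<kappa> \<le> 3"
    and "(\<Delta> + real S * ((1 + 2 * t) * \<eta>)) / \<kappa>
      \<le> real S * ((2 * K + 1) * \<Delta> / ((1 - K) * (real S + 1)) + 3 * \<eta> / (1 - K))"
proof -
  have suffices: "(\<Delta> + real S * ((1 + 2 * t) * \<eta>)) / \<kappa>
      \<le> real S * ((2 * K + 1) * \<Delta> / ((1 - K) * (real S + 1)) + 3 * \<eta> / (1 - K))"
    if \<kappa>: "0 < \<kappa>" and D: "(1 - K) * (real S + 1) \<le> \<kappa> * (real S * (2 * K + 1))"
      and e: "(1 + 2 * t) * (1 - K) \<le> 3 * \<kappa>" for t \<kappa>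
  proof -
    have "0 < (1 - K) * (real S + 1)" using K by simp
    then have "1 / \<kappa> \<le> real S * (2 * K + 1) / ((1 - K) * (real S + 1))"
      using \<kappa> D divide_le_eq[of 1 \<kappa>] pos_le_divide_eq[of "(1 - K) * (real S + 1)" "1 / \<kappa>"]
      by (simp add: pos_divide_le_eq mult.commute)
    then have 1: "1 / \<kappa> * \<Delta> \<le> real S * (2 * K + 1) / ((1 - K) * (real S + 1)) * \<Delta>"
      using nonneg by (intro mult_right_mono)
    have "(1 + 2 * t) / \<kappa> \<le> 3 / (1 - K)"
      using \<kappa> e K by (simp add: field_simps)
    then have 2: "(1 + 2 * t) / \<kappa> * (real S * \<eta>) \<le> 3 / (1 - K) * (real S * \<eta>)"
      using nonneg by (intro mult_right_mono) auto
    from add_mono[OF 1 2] show ?thesis by (simp add: algebra_simps add_divide_distrib)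
  qed
  have S1: "1 \<le> real S" using S by simp
  have double: "(1 - K) * (real S + 1) \<le> \<kappa> * (real S * (2 * K + 1))"
    if "2 * (1 - K) \<le> \<kappa> * (2 * K + 1)" for \<kappa>
  proof -
    have "(1 - K) * (real S + 1) \<le> (1 - K) * (2 * real S)"
      using K S1 by (intro mult_left_mono) auto
    also have "\<dots> \<le> \<kappa> * (2 * K + 1) * real S"
      using mult_right_mono[OF that, of "real S"] by (simp add: algebra_simps)
    finally show ?thesis by (simp add: algebra_simps)
  qed
  consider "K \<le> 1 / 4" | "1 / 4 \<le> K" "K \<le> 1 / 2" | "1 / 2 \<le> K" by linarith
  then show thesis
  proof cases
    case 1
    have "0 \<le> K * (3 - 6 * K)" using 1 K by simp
    then have "2 * (1 - K) \<le> (2 - 3 * K) * (2 * K + 1)" by (simp add: algebra_simps)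
    then show thesis using 1 K by (intro that[of 1 "2 - 3 * K"] suffices double) auto
  next
    case 2
    have "0 \<le> (4 * K - 1) * (1 - 2 * K)" using 2 by (intro mult_nonneg_nonneg) auto
    then have "2 * (1 - K) \<le> (3 / 2 - 2 * K) * (2 * K + 1)" by (simp add: algebra_simps)
    then show thesis using 2 K by (intro that[of "1/2" "3 / 2 - 2 * K"] suffices double) (auto simp: field_simps)
  next
    case 3
    have "1 * 1 \<le> (2 * K) * real S" using 3 S1 by (intro mult_mono) auto
    then have "(1 - K) * (real S + 1) \<le> (1 - K) * (real S * (2 * K + 1))"
      using K by (intro mult_left_mono) (auto simp: algebra_simps)
    then show thesis using 3 K by (intro that[of 0 "1 - K"] suffices) auto
  qed
qed

theorem theorem2:
  fixes fs :: "nat \<Rightarrow> 'a::euclidean_space \<Rightarrow> real"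
    and f r F :: "'a \<Rightarrow> real"
    and A :: "'a algorithm"
    and C :: "real \<Rightarrow> real \<Rightarrow> nat"
    and n S :: nat
    and L \<sigma> \<gamma> lam \<Delta> \<delta> K E :: real
    and x0 xopt :: 'a
  assumes "1 \<le> n"
    and "f = (\<lambda>x. 1 / real n * (\<Sum>i=1..n. fs i x))"
    and "F = (\<lambda>x. f x + r x)"
    and "\<forall>i\<in>{1..n}. L_smooth L (fs i)"
    and "0 < \<sigma>"
    and "weakly_convex \<sigma> f"
    and "convex_on UNIV r"
    and "is_arg_min F (\<lambda>_. True) xopt"
    and "F x0 - F xopt \<le> \<Delta>"
    and "1 \<le> S"
    and "lam = 1 / (2 * \<sigma>)"
    and "(\<lambda>c. A (reg_objective F lam c) c) \<in> borel \<rightarrow>\<^sub>M prob_algebra run_space"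
    and "\<forall>c. ZOOD A (reg_objective F lam c) C L \<gamma> \<delta> K E"
  shows "integrable (AdaptRdct_NC A F lam x0 S)
           (\<lambda>x. (norm (gradient (moreau_envelope lam F) x))\<^sup>2) \<and>
         (\<integral>x. (norm (gradient (moreau_envelope lam F) x))\<^sup>2 \<partial>AdaptRdct_NC A F lam x0 S)
           \<le> 8 * \<sigma> * (2 * K + 1) * \<Delta> / ((1 - K) * (real S + 1))
              + 24 * \<sigma> * \<delta> + 24 * \<sigma> * E / (1 - K)"
proof -
  interpret weakly_convex_min F \<sigma> xopt
  proof
    show "weakly_convex \<sigma> F" unfolding assms(3) by (rule weakly_convex_add_convex[OF assms(6,7)])
    show "F xopt \<le> F x" for x using assms(8) by (simp add: is_arg_min_linorder)
  qed fact
  have zood: "ZOOD A (reg c) C L \<gamma> \<delta> K E" for c using assms(11,13) by simp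
  then have K: "0 < K" "K < 1" and nonneg: "0 \<le> \<delta>" "0 \<le> E" by (auto simp: ZOOD_def)
  define \<eta> where "\<eta> = (1 - K) * \<delta> + E"
  have \<eta>: "0 \<le> \<eta>" using K nonneg by (simp add: \<eta>_def)
  have \<Delta>: "0 \<le> \<Delta>" using minimal[of x0] assms(9) by simp
  obtain t \<kappa> where t: "0 \<le> t" "t \<le> 1" "2 * t * K \<le> 1 - K"
    and \<kappa>: "\<kappa> = 1 - K + t * (1 - 2 * K)" "0 < \<kappa>" "\<kappa> \<le> 3"
    and rate: "(\<Delta> + real S * ((1 + 2 * t) * \<eta>)) / \<kappa>
      \<le> real S * ((2 * K + 1) * \<Delta> / ((1 - K) * (real S + 1)) + 3 * \<eta> / (1 - K))"
    using rate_constants[OF K assms(10) \<Delta> \<eta>] by blast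
  define k where "k = (\<lambda>x. distr (A (reg x) x) borel fst)"
  define M where "M = AdaptRdct_NC_iterate A F lam x0"
  have kernel: "k \<in> borel \<rightarrow>\<^sub>M prob_algebra borel"
    unfolding k_def using assms(11,12)
    by (intro measurable_compose[OF _ measurable_distr_prob_space]) auto
  have drift: "(\<integral>\<^sup>+y. ennreal (F y - F xopt) \<partial>k x) + ennreal (\<kappa> * residual x)
      \<le> ennreal (F x - F xopt) + ennreal ((1 + 2 * t) * \<eta>)" for x
  proof -
    let ?P = "A (reg x) x"
    \<comment> \<open>The law of the run is pushed forward to the output point; at the start the penalty vanishes.\<close>
    have "?P \<in> space (prob_algebra run_space)" and int: "integrable ?P (\<lambda>p. reg x (fst p))"
      and dec: "(\<integral>p. (reg x (fst p) - envelope x - \<delta>) \<partial>?P) \<le> K * (reg x x - envelope x - \<delta>) + E"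
      using zood[of x] by (auto simp: ZOOD_def moreau_envelope_def)
    then have P: "prob_space ?P" "sets ?P = sets run_space" by (auto simp: space_prob_algebra)
    have fst: "fst \<in> ?P \<rightarrow>\<^sub>M borel"
      using P(2) by (subst measurable_cong_sets[OF P(2) refl]) simp
    have [measurable]: "reg x \<in> borel_measurable borel" unfolding reg_eq by measurable
    show ?thesis
      unfolding \<kappa>(1) \<eta>_def
    proof (rule expected_step_decrease[OF t])
      show "prob_space (k x)" unfolding k_def by (rule prob_space.prob_space_distr[OF P(1) fst])
      show "sets (k x) = sets borel" by (simp add: k_def)
      show "integrable (k x) (reg x)" using int unfolding k_def by (simp add: integrable_distr_eq fst)
      show "(\<integral>y. (reg x y - envelope x - \<delta>) \<partial>k x) \<le> K * (F x - envelope x - \<delta>) + E"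
        using dec unfolding k_def by (simp add: integral_distr fst) (simp add: reg_eq)
    qed (use \<eta> in \<open>simp add: \<eta>_def\<close>)
  qed
  have M0: "M 0 = return borel x0" by (simp add: M_def)
  have start: "M 0 \<in> space (prob_algebra borel)"
    by (auto simp: M0 space_prob_algebra intro: prob_space_return)
  have step: "M (Suc s) = M s \<bind> k" for s by (simp add: M_def k_def assms(11))
  note chain = nn_integral_drift_sum[where k = k and N = borel and M = M
      and \<phi> = "\<lambda>x. ennreal (F x - F xopt)" and \<beta> = "\<lambda>x. ennreal (\<kappa> * residual x)",
      OF kernel start step _ _ drift]
  have M: "M s \<in> space (prob_algebra borel)" for s
    by (rule chain(1)) measurable
  have total: "(\<integral>\<^sup>+x. ennreal (F x - F xopt) \<partial>M S) + (\<Sum>s<S. \<integral>\<^sup>+x. ennreal (\<kappa> * residual x) \<partial>M s)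
      \<le> (\<integral>\<^sup>+x. ennreal (F x - F xopt) \<partial>M 0) + of_nat S * ennreal ((1 + 2 * t) * \<eta>)"
    by (rule chain(2)) measurable
  have sets_M [measurable_cong]: "sets (M s) = sets borel" for s
    using M[of s] by (simp add: space_prob_algebra)
  define b where "b s = (\<integral>\<^sup>+x. ennreal (residual x) \<partial>M s)" for s
  have \<kappa>b: "(\<integral>\<^sup>+x. ennreal (\<kappa> * residual x) \<partial>M s) = ennreal \<kappa> * b s" for s
    using \<kappa> residual_nonneg by (simp add: b_def ennreal_mult nn_integral_cmult)
  \<comment> \<open>The last residual is exchanged for the terminal gap, which \<open>\<kappa> \<le> 3\<close> allows.\<close>
  have "ennreal \<kappa> * (\<Sum>s=1..S. b s) \<le> ennreal \<kappa> * (b S + (\<Sum>s<S. b s))"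
  proof (intro mult_left_mono)
    have "(\<Sum>s=1..S. b s) \<le> (\<Sum>s\<in>insert S {..<S}. b s)"
      by (intro sum_mono2) auto
    then show "(\<Sum>s=1..S. b s) \<le> b S + (\<Sum>s<S. b s)" by simp
  qed simp
  also have "\<dots> = (\<integral>\<^sup>+x. ennreal (\<kappa> * residual x) \<partial>M S) + (\<Sum>s<S. \<integral>\<^sup>+x. ennreal (\<kappa> * residual x) \<partial>M s)"
    by (simp add: \<kappa>b distrib_left sum_distrib_left)
  also have "\<dots> \<le> (\<integral>\<^sup>+x. ennreal (F x - F xopt) \<partial>M S) + (\<Sum>s<S. \<integral>\<^sup>+x. ennreal (\<kappa> * residual x) \<partial>M s)"
  proof (intro add_right_mono nn_integral_mono ennreal_leI)
    fix x
    have "\<kappa> * residual x \<le> 3 * residual x"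
      using \<kappa> residual_nonneg by (intro mult_right_mono) auto
    then show "\<kappa> * residual x \<le> F x - F xopt" using three_residual_le_gap[of x] by simp
  qed
  also have "\<dots> \<le> (\<integral>\<^sup>+x. ennreal (F x - F xopt) \<partial>M 0) + of_nat S * ennreal ((1 + 2 * t) * \<eta>)"
    by (rule total)
  also have "\<dots> = ennreal (F x0 - F xopt) + ennreal (real S * ((1 + 2 * t) * \<eta>))"
    using t \<eta> by (simp add: M0 nn_integral_return ennreal_mult ennreal_of_nat_eq_real_of_nat)
  also have "\<dots> \<le> ennreal (\<Delta> + real S * ((1 + 2 * t) * \<eta>))"
    using t \<eta> minimal[of x0] assms(9) by (simp flip: ennreal_plus)
  finally have "ennreal (1 / \<kappa>) * (ennreal \<kappa> * (\<Sum>s=1..S. b s))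
      \<le> ennreal (1 / \<kappa>) * ennreal (\<Delta> + real S * ((1 + 2 * t) * \<eta>))"
    by (intro mult_left_mono) auto
  moreover have "ennreal (1 / \<kappa>) * (ennreal \<kappa> * (\<Sum>s=1..S. b s)) = (\<Sum>s=1..S. b s)"
    using \<kappa>(2) by (simp flip: mult.assoc ennreal_mult)
  moreover have "ennreal (1 / \<kappa>) * ennreal (\<Delta> + real S * ((1 + 2 * t) * \<eta>))
      = ennreal ((\<Delta> + real S * ((1 + 2 * t) * \<eta>)) / \<kappa>)"
    using \<kappa>(2) \<Delta> t \<eta> by (subst ennreal_mult[symmetric]) (auto simp del: ennreal_plus)
  ultimately have sum_b: "(\<Sum>s=1..S. b s)
      \<le> ennreal (real S * ((2 * K + 1) * \<Delta> / ((1 - K) * (real S + 1)) + 3 * \<eta> / (1 - K)))"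
    using rate ennreal_leI order_trans by fastforce
  define R where "R = (2 * K + 1) * \<Delta> / ((1 - K) * (real S + 1)) + 3 * \<eta> / (1 - K)"
  have R: "0 \<le> R" using K \<Delta> \<eta> by (simp add: R_def)
  define out where "out = AdaptRdct_NC A F lam x0 S"
  have out: "out = measure_pmf (pmf_of_set {1..S}) \<bind> M" by (simp add: out_def AdaptRdct_NC_def M_def)
  have M_kernel: "M \<in> measure_pmf (pmf_of_set {1..S}) \<rightarrow>\<^sub>M subprob_algebra borel"
    using M by (auto simp: space_prob_algebra space_subprob_algebra
        intro: prob_space_imp_subprob_space)
  have sets_out [measurable_cong]: "sets out = sets borel"
    unfolding out by (rule sets_bind) (auto simp: sets_M)
  have "(\<integral>\<^sup>+x. ennreal (residual x) \<partial>out) = (\<Sum>s=1..S. b s) / ennreal (real S)"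
    unfolding out b_def using assms(10)
    by (subst nn_integral_bind[OF _ M_kernel]) (auto simp: nn_integral_pmf_of_set ennreal_of_nat_eq_real_of_nat)
  also have "\<dots> \<le> ennreal (real S * R) / ennreal (real S)"
    using sum_b unfolding R_def by (rule divide_right_mono_ennreal)
  also have "\<dots> = ennreal R"
    using assms(10) R by (subst divide_ennreal) auto
  finally have bound: "(\<integral>\<^sup>+x. ennreal (residual x) \<partial>out) \<le> ennreal R" .
  have int: "integrable out residual"
    using bound residual_nonneg
    by (intro integrableI_nonneg) (auto simp: less_top[symmetric] top_unique)
  then have "ennreal (\<integral>x. residual x \<partial>out) \<le> ennreal R"
    using bound residual_nonneg by (simp add: nn_integral_eq_integral)
  then have "(\<integral>x. residual x \<partial>out) \<le> R" using R by (simp add: ennreal_le_iff)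
  then have "8 * \<sigma> * (\<integral>x. residual x \<partial>out) \<le> 8 * \<sigma> * R"
    using sigma_pos by (intro mult_left_mono) auto
  moreover have "8 * \<sigma> * R = 8 * \<sigma> * (2 * K + 1) * \<Delta> / ((1 - K) * (real S + 1))
      + 24 * \<sigma> * \<delta> + 24 * \<sigma> * E / (1 - K)"
  proof -
    have "\<eta> / (1 - K) = \<delta> + E / (1 - K)" using K by (simp add: \<eta>_def add_divide_distrib)
    then show ?thesis by (simp add: R_def distrib_left flip: times_divide_eq_right)
  qed
  ultimately show ?thesis
    using int unfolding assms(11) gradient_envelope_residual out_def assms(11) by simp
qed

end
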